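(* Let $(a_n)_{n\ge0}$ be a real sequence with $a_0\ne0$, let $(R_n)$ be the Appell sequence generated by $(a_n)$, and let $f$ be a real function defined for all sufficiently large arguments with \[ f(x)\sim\sum_{n\ge0}(-1)^n\frac{a_n}{x^{n+1}}\qquad(x\to\infty). \] Then the expansion $f(x+t)\sim\sum_{n\ge0}(-1)^nR_n(t)x^{-n-1}$ holds uniformly for $t$ in compact subsets of $\mathbb R$: for every $T>0$ and every integer $N\ge0$, \[ f(x+t)=\sum_{n=0}^{N}(-1)^n\frac{R_n(t)}{x^{n+1}}+o\bigl(x^{-N-1}\bigr)\qquad(x\to\infty), \] the $o$ being uniform for $|t|\le T$. Consequently, if $(t_x)_{x>0}$ is any family of real numbers with $|t_x|\le T$ for all $x$, then for every $N$ \[ f(x+t_x)=\sum_{n=0}^{N}(-1)^n\frac{R_n(t_x)}{x^{n+1}}+o\bigl(x^{-N-1}\bigr)\qquad(x\to\infty), \] even when $t_x$ has no limit as $x\to\infty$.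
   Context: The Appell sequence generated by $(a_n)$ is the polynomial sequence $R_n(t)=\sum_{k=0}^n\binom nk a_k t^{n-k}$, equivalently $A(z)e^{tz}=\sum_{n\ge0}R_n(t)\frac{z^n}{n!}$ with the formal power series $A(z)=\sum_{k\ge0}a_k\frac{z^k}{k!}$. The notation $f(x)\sim\sum_{n\ge0}(-1)^na_nx^{-n-1}$ means that for every $N\ge0$, $f(x)=\sum_{n=0}^N(-1)^na_nx^{-n-1}+o(x^{-N-1})$ as $x\to\infty$. *)

theory Defs
  imports Complex_Main "HOL-Library.Landau_Symbols"
begin

definition appell :: "(nat \<Rightarrow> real) \<Rightarrow> nat \<Rightarrow> real \<Rightarrow> real" where
  "appell a n t = (\<Sum>k\<le>n. real (n choose k) * a k * t ^ (n - k))"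

definition alt_psum :: "(nat \<Rightarrow> real) \<Rightarrow> nat \<Rightarrow> real \<Rightarrow> real" where
  "alt_psum c N x = (\<Sum>n\<le>N. (-1) ^ n * (c n / x ^ (n + 1)))"

text \<open>
  Functions defined only for large arguments are represented by total functions: values of
  \<open>f\<close> outside a neighbourhood of \<open>at_top\<close> play no role here.
\<close>

definition has_alt_expansion :: "(real \<Rightarrow> real) \<Rightarrow> (nat \<Rightarrow> real) \<Rightarrow> bool" where
  "has_alt_expansion f c \<longleftrightarrow>
     (\<forall>N. (\<lambda>x. f x - alt_psum c N x) \<in> o[at_top](\<lambda>x. 1 / x ^ (N + 1)))"

text \<open>
  \<open>h x t = o(g x)\<close> as \<open>x\<close> tends to infinity, uniformly for \<open>t \<in> S\<close>: the threshold
  for \<open>x\<close> may depend on \<open>\<epsilon>\<close> but not on \<open>t\<close>.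
\<close>

definition uniform_smallo ::
    "real set \<Rightarrow> (real \<Rightarrow> real \<Rightarrow> real) \<Rightarrow> (real \<Rightarrow> real) \<Rightarrow> bool" where
  "uniform_smallo S h g \<longleftrightarrow>
     (\<forall>\<epsilon>>0. \<forall>\<^sub>F x in at_top. \<forall>t\<in>S. \<bar>h x t\<bar> \<le> \<epsilon> * \<bar>g x\<bar>)"

end

theory Submission
  imports Defs "HOL-Analysis.Elementary_Normed_Spaces" "HOL-Real_Asymp.Real_Asymp"
begin

text \<open>
  With \<open>w = t / x\<close>, the expansion \<open>(x + t) ^ - (k + 1) = x ^ - (k + 1) * (1 + w) ^ - (k + 1)\<close>
  by the negative binomial series has a remainder bounded by a multiple of \<open>\<bar>w\<bar> ^ (M + 1)\<close> for
  \<open>\<bar>w\<bar> \<le> 1 / 2\<close>, hence uniformly for bounded \<open>t\<close>. Substituting these expansions into the partial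
  sums of the expansion of \<open>f\<close> and collecting powers of \<open>1 / x\<close> produces the Appell
  polynomials. Uniformity in \<open>t \<in> S\<close> is smallness along the product filter
  \<open>at_top \<times>\<^sub>F principal S\<close>, so the calculus of Landau symbols applies to it.
\<close>

section \<open>Uniform smallness as smallness along a product filter\<close>

lemma eventually_prod_principal_iff:
  "eventually P (F \<times>\<^sub>F principal S) \<longleftrightarrow> (\<forall>\<^sub>F x in F. \<forall>t\<in>S. P (x, t))"
proof
  assume "eventually P (F \<times>\<^sub>F principal S)"
  then obtain Pf Pg where "eventually Pf F" and Pg: "\<forall>t\<in>S. Pg t"
    and P: "\<And>x t. Pf x \<Longrightarrow> Pg t \<Longrightarrow> P (x, t)"
    unfolding eventually_prod_filter eventually_principal by blast
  from this(1) show "\<forall>\<^sub>F x in F. \<forall>t\<in>S. P (x, t)"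
    by eventually_elim (use P Pg in blast)
next
  assume "\<forall>\<^sub>F x in F. \<forall>t\<in>S. P (x, t)"
  then show "eventually P (F \<times>\<^sub>F principal S)"
    unfolding eventually_prod_filter eventually_principal
    by (intro exI[of _ "\<lambda>x. \<forall>t\<in>S. P (x, t)"] exI[of _ "\<lambda>t. t \<in> S"]) auto
qed

lemma uniform_smallo_iff_smallo_prod:
  "uniform_smallo S h g \<longleftrightarrow>
     (\<lambda>p. h (fst p) (snd p)) \<in> o[at_top \<times>\<^sub>F principal S](\<lambda>p. g (fst p))"
  by (simp add: uniform_smallo_def smallo_def eventually_prod_principal_iff)

lemma uniform_smallo_subset:
  assumes "uniform_smallo S h g" "S' \<subseteq> S"
  shows "uniform_smallo S' h g"
  unfolding uniform_smallo_def
proof (intro allI impI)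
  fix \<epsilon> :: real assume "\<epsilon> > 0"
  with assms(1) have "\<forall>\<^sub>F x in at_top. \<forall>t\<in>S. \<bar>h x t\<bar> \<le> \<epsilon> * \<bar>g x\<bar>"
    unfolding uniform_smallo_def by blast
  then show "\<forall>\<^sub>F x in at_top. \<forall>t\<in>S'. \<bar>h x t\<bar> \<le> \<epsilon> * \<bar>g x\<bar>"
    by eventually_elim (use assms(2) in blast)
qed

text \<open>Since the threshold for \<open>x\<close> does not depend on \<open>t\<close>, one may
  put \<open>t = \<tau> x\<close> pointwise; \<open>\<tau>\<close> needs neither a limit nor any
  regularity.\<close>

lemma uniform_smallo_imp_smallo_family:
  assumes "uniform_smallo S h g" "\<forall>\<^sub>F x in at_top. \<tau> x \<in> S"
  shows "(\<lambda>x. h x (\<tau> x)) \<in> o[at_top](g)"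
proof (rule landau_o.smallI)
  fix c :: real assume "c > 0"
  with assms(1) have "\<forall>\<^sub>F x in at_top. \<forall>t\<in>S. \<bar>h x t\<bar> \<le> c * \<bar>g x\<bar>"
    unfolding uniform_smallo_def by blast
  with assms(2) show "\<forall>\<^sub>F x in at_top. norm (h x (\<tau> x)) \<le> c * norm (g x)"
    by eventually_elim auto
qed

section \<open>Truncations of the negative binomial series of \<open>(1 + w) ^ - (k + 1)\<close> at
  degree \<open>M\<close>\<close>

definition neg_binomial_psum :: "nat \<Rightarrow> nat \<Rightarrow> real \<Rightarrow> real" where
  "neg_binomial_psum k M w = (\<Sum>j\<le>M. (-1) ^ j * real ((k + j) choose j) * w ^ j)"

lemma neg_binomial_psum_0: "(1 + w) * neg_binomial_psum 0 M w = 1 - (- w) ^ (M + 1)"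
  by (induction M) (simp_all add: neg_binomial_psum_def algebra_simps power_minus[of w])

text \<open>Multiplication by \<open>1 + w\<close> lowers the order of the pole by one. On
  coefficients this is Pascal's rule, and truncation leaves a single uncancelled term, of degree
  \<open>M + 1\<close>.\<close>

lemma neg_binomial_psum_Suc:
  "(1 + w) * neg_binomial_psum (Suc k) M w =
     neg_binomial_psum k M w + (-1) ^ M * real ((Suc k + M) choose M) * w ^ (M + 1)"
proof (induction M)
  case 0
  show ?case by (simp add: neg_binomial_psum_def)
next
  case (Suc M)
  have pascal: "real ((Suc k + Suc M) choose Suc M) =
      real ((Suc k + M) choose M) + real ((k + Suc M) choose Suc M)"
    by simp
  have step: "neg_binomial_psum k' (Suc M) w = neg_binomial_psum k' M w
      + (-1) ^ Suc M * real ((k' + Suc M) choose Suc M) * w ^ Suc M" for k'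
    by (simp add: neg_binomial_psum_def)
  show ?case
    unfolding step distrib_left Suc.IH pascal by (simp add: algebra_simps)
qed

text \<open>Induction on \<open>k\<close> replaces Taylor's theorem. The geometric sum gives the
  base case. In the step, \<open>1 + w\<close> times the new remainder is the old remainder minus
  the uncancelled term of \<open>neg_binomial_psum_Suc\<close>, both of order \<open>M + 1\<close>
  in \<open>w\<close>. Dividing by \<open>1 + w\<close> costs at most a factor 2, because
  \<open>\<bar>1 + w\<bar> \<ge> 1 / 2\<close>.\<close>

lemma neg_binomial_remainder_bound:
  obtains C where "\<And>w :: real. \<bar>w\<bar> \<le> 1 / 2 \<Longrightarrow>
    \<bar>1 / (1 + w) ^ (k + 1) - neg_binomial_psum k M w\<bar> \<le> C * \<bar>w\<bar> ^ (M + 1)"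
proof -
  have "\<exists>C. \<forall>w :: real. \<bar>w\<bar> \<le> 1 / 2 \<longrightarrow>
    \<bar>1 / (1 + w) ^ (k + 1) - neg_binomial_psum k M w\<bar> \<le> C * \<bar>w\<bar> ^ (M + 1)"
  proof (induction k)
    case 0
    show ?case
    proof (intro exI[of _ 2] allI impI)
      fix w :: real assume w: "\<bar>w\<bar> \<le> 1 / 2"
      then have "1 / (1 + w) ^ (0 + 1) - neg_binomial_psum 0 M w = (- w) ^ (M + 1) / (1 + w)"
        using neg_binomial_psum_0[of w M] by (simp add: field_simps)
      moreover have "\<bar>w\<bar> ^ (M + 1) / \<bar>1 + w\<bar> \<le> \<bar>w\<bar> ^ (M + 1) / (1 / 2)"
        using w by (intro divide_left_mono) auto
      ultimately show "\<bar>1 / (1 + w) ^ (0 + 1) - neg_binomial_psum 0 M w\<bar> \<le> 2 * \<bar>w\<bar> ^ (M + 1)"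
        by (simp only: abs_divide power_abs abs_minus_cancel) simp
    qed
  next
    case (Suc k)
    then obtain C where C: "\<And>w :: real. \<bar>w\<bar> \<le> 1 / 2 \<Longrightarrow>
      \<bar>1 / (1 + w) ^ (k + 1) - neg_binomial_psum k M w\<bar> \<le> C * \<bar>w\<bar> ^ (M + 1)"
      by blast
    define D where "D = real ((Suc k + M) choose M)"
    show ?case
    proof (intro exI[of _ "2 * (C + D)"] allI impI)
      fix w :: real assume w: "\<bar>w\<bar> \<le> 1 / 2"
      define r where "r = 1 / (1 + w) ^ (k + 1) - neg_binomial_psum k M w"
      define r' where "r' = 1 / (1 + w) ^ (Suc k + 1) - neg_binomial_psum (Suc k) M w"
      have "1 + w \<noteq> 0"
        using w by linarith
      then have "(1 + w) * r' = r - (-1) ^ M * D * w ^ (M + 1)"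
        using neg_binomial_psum_Suc[of w k M] by (simp add: r_def r'_def D_def right_diff_distrib)
      then have "\<bar>1 + w\<bar> * \<bar>r'\<bar> \<le> \<bar>r\<bar> + \<bar>(-1) ^ M * D * w ^ (M + 1)\<bar>"
        by (metis abs_mult abs_triangle_ineq4)
      moreover have "\<bar>(-1) ^ M * D * w ^ (M + 1)\<bar> = D * \<bar>w\<bar> ^ (M + 1)"
        by (simp add: abs_mult power_abs D_def)
      moreover have "\<bar>r\<bar> \<le> C * \<bar>w\<bar> ^ (M + 1)"
        using C[OF w] by (simp add: r_def)
      moreover have "1 / 2 * \<bar>r'\<bar> \<le> \<bar>1 + w\<bar> * \<bar>r'\<bar>"
        using w by (intro mult_right_mono) auto
      ultimately have "\<bar>r'\<bar> \<le> 2 * (C + D) * \<bar>w\<bar> ^ (M + 1)"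
        by (simp add: algebra_simps)
      then show "\<bar>1 / (1 + w) ^ (Suc k + 1) - neg_binomial_psum (Suc k) M w\<bar>
          \<le> 2 * (C + D) * \<bar>w\<bar> ^ (M + 1)"
        by (simp only: r'_def)
    qed
  qed
  then show ?thesis using that by blast
qed

text \<open>An exact identity: the double sum is regrouped by the index \<open>k\<close> of the
  coefficient \<open>a k\<close>. Keeping the powers of \<open>1 / x\<close> up to
  \<open>N + 1\<close> truncates the series attached to \<open>a k\<close> at degree
  \<open>N - k\<close>.\<close>

lemma alt_psum_appell:
  assumes "x \<noteq> 0"
  shows "alt_psum (\<lambda>n. appell a n t) N x =
    (\<Sum>k\<le>N. (-1) ^ k * a k * (neg_binomial_psum k (N - k) (t / x) / x ^ (k + 1)))"
proof -
  \<comment> \<open>The contribution of \<open>a k\<close> and \<open>t ^ j\<close>; it belongs to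
    the summand \<open>n = k + j\<close>.\<close>
  define g where "g k j = (-1) ^ (k + j) * (real ((k + j) choose k) * a k * t ^ j / x ^ (k + j + 1))"
    for k j
  have "alt_psum (\<lambda>n. appell a n t) N x = (\<Sum>n\<le>N. \<Sum>k\<le>n. g k (n - k))"
    unfolding alt_psum_def appell_def g_def
    by (auto intro!: sum.cong simp: sum_distrib_left sum_divide_distrib)
  also have "\<dots> = (\<Sum>(k, j)\<in>{(k, j). k + j \<le> N}. g k j)"
    by (rule sum.triangle_reindex_eq[symmetric])
  also have "{(k, j). k + j \<le> N} = (SIGMA k:{..N}. {..N - k})"
    by auto
  also have "(\<Sum>(k, j)\<in>(SIGMA k:{..N}. {..N - k}). g k j) = (\<Sum>k\<le>N. \<Sum>j\<le>N - k. g k j)"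
    by (rule sum.Sigma[symmetric]) auto
  also have "\<dots> = (\<Sum>k\<le>N. (-1) ^ k * a k * (neg_binomial_psum k (N - k) (t / x) / x ^ (k + 1)))"
  proof (rule sum.cong[OF refl])
    fix k
    have "g k j = (-1) ^ k * a k * ((-1) ^ j * real ((k + j) choose j) * (t / x) ^ j / x ^ (k + 1))"
      for j
      using assms binomial_symmetric[of k "k + j"]
      by (simp add: g_def power_add power_divide field_simps)
    then show "(\<Sum>j\<le>N - k. g k j) =
        (-1) ^ k * a k * (neg_binomial_psum k (N - k) (t / x) / x ^ (k + 1))"
      by (simp add: neg_binomial_psum_def sum_distrib_left sum_divide_distrib)
  qed
  finally show ?thesis .
qed

lemma eventually_prod_bounded_large:
  fixes c T :: real
  shows "\<forall>\<^sub>F p in at_top \<times>\<^sub>F principal {t. \<bar>t\<bar> \<le> T}. fst p \<ge> c \<and> \<bar>snd p\<bar> \<le> T"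
  unfolding eventually_prod_principal_iff
  using eventually_ge_at_top[of c] by eventually_elim auto

text \<open>This permits substituting \<open>x + t\<close> into asymptotic statements in one
  variable while keeping uniformity in \<open>t\<close>.\<close>

lemma filterlim_add_prod_bounded:
  "filterlim (\<lambda>p. fst p + snd p) at_top (at_top \<times>\<^sub>F principal {t :: real. \<bar>t\<bar> \<le> T})"
  unfolding filterlim_at_top
proof
  fix Z :: real
  show "\<forall>\<^sub>F p in at_top \<times>\<^sub>F principal {t. \<bar>t\<bar> \<le> T}. Z \<le> fst p + snd p"
    using eventually_prod_bounded_large[of "Z + T" T] by eventually_elim auto
qed

text \<open>Factoring out \<open>x ^ - (k + 1)\<close> leaves the remainder at
  \<open>w = t / x\<close>. Since \<open>\<bar>w\<bar> \<le> T / x\<close>, it contributes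
  \<open>M + 1\<close> further powers of \<open>1 / x\<close>, with a constant independent of
  \<open>t\<close>.\<close>

lemma inverse_power_shift_expansion:
  fixes T :: real
  assumes "T > 0"
  shows "(\<lambda>p. 1 / (fst p + snd p) ^ (k + 1)
            - neg_binomial_psum k M (snd p / fst p) / fst p ^ (k + 1))
          \<in> O[at_top \<times>\<^sub>F principal {t. \<bar>t\<bar> \<le> T}](\<lambda>p. 1 / fst p ^ (k + M + 2))"
proof -
  obtain C where C: "\<And>w :: real. \<bar>w\<bar> \<le> 1 / 2 \<Longrightarrow>
    \<bar>1 / (1 + w) ^ (k + 1) - neg_binomial_psum k M w\<bar> \<le> C * \<bar>w\<bar> ^ (M + 1)"
    using neg_binomial_remainder_bound[of k M] by blast
  \<comment> \<open>The sign of \<open>C\<close> is read off from the bound at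
    \<open>w = 1 / 2\<close>; it is needed below to replace \<open>\<bar>t / x\<bar>\<close> by
    \<open>T / x\<close>.\<close>
  have "0 \<le> C * (1 / 2 :: real) ^ (M + 1)"
    using order_trans[OF abs_ge_zero C[of "1 / 2"]] by simp
  moreover have "(0 :: real) < (1 / 2) ^ (M + 1)"
    by (rule zero_less_power) simp
  ultimately have "C \<ge> 0"
    by (simp only: zero_le_mult_iff) linarith
  show ?thesis
  proof (rule bigoI[where c = "C * T ^ (M + 1)"])
    show "\<forall>\<^sub>F p in at_top \<times>\<^sub>F principal {t. \<bar>t\<bar> \<le> T}.
        norm (1 / (fst p + snd p) ^ (k + 1)
            - neg_binomial_psum k M (snd p / fst p) / fst p ^ (k + 1))
        \<le> C * T ^ (M + 1) * norm (1 / fst p ^ (k + M + 2))"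
      \<comment> \<open>From \<open>x \<ge> 2 * T\<close> follow \<open>x > 0\<close> and
        \<open>\<bar>t / x\<bar> \<le> 1 / 2\<close>, the range of the remainder bound.\<close>
      using eventually_prod_bounded_large[of "2 * T" T]
    proof eventually_elim
      case (elim p)
      obtain x t where p: "p = (x, t)" by (cases p)
      with elim assms have x: "x > 0" and "x \<ge> 2 * T" and t: "\<bar>t\<bar> \<le> T" by auto
      then have w: "\<bar>t / x\<bar> \<le> 1 / 2"
        by (simp add: abs_divide field_simps)
      have "x + t = x * (1 + t / x)"
        using x by (simp add: field_simps)
      then have "1 / (x + t) ^ (k + 1) - neg_binomial_psum k M (t / x) / x ^ (k + 1) =
          (1 / (1 + t / x) ^ (k + 1) - neg_binomial_psum k M (t / x)) / x ^ (k + 1)"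
        by (simp only: power_mult_distrib diff_divide_distrib divide_divide_eq_left mult.commute)
      then have "\<bar>1 / (x + t) ^ (k + 1) - neg_binomial_psum k M (t / x) / x ^ (k + 1)\<bar> =
          \<bar>1 / (1 + t / x) ^ (k + 1) - neg_binomial_psum k M (t / x)\<bar> / x ^ (k + 1)"
        using x by (simp only: abs_divide) simp
      also have "\<dots> \<le> C * \<bar>t / x\<bar> ^ (M + 1) / x ^ (k + 1)"
        using x C[OF w] by (intro divide_right_mono) auto
      also have "\<dots> \<le> C * (T / x) ^ (M + 1) / x ^ (k + 1)"
        using x t \<open>C \<ge> 0\<close>
        by (intro divide_right_mono mult_left_mono power_mono) (auto simp: abs_divide divide_right_mono)
      also have "\<dots> = C * T ^ (M + 1) * \<bar>1 / x ^ (k + M + 2)\<bar>"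
        using x by (simp add: power_divide power_add field_simps)
      finally show ?case
        by (simp add: p)
    qed
  qed
qed

text \<open>With truncation degree \<open>M = N - k\<close> the exponent \<open>k + M + 2\<close>
  equals \<open>N + 2\<close> for every \<open>k \<le> N\<close>. All finitely many remainders are
  thus one power of \<open>1 / x\<close> smaller than required.\<close>

lemma alt_psum_shift:
  fixes T :: real
  assumes "T > 0"
  defines "F \<equiv> at_top \<times>\<^sub>F principal {t. \<bar>t\<bar> \<le> T}"
  shows "(\<lambda>p. alt_psum a N (fst p + snd p) - alt_psum (\<lambda>n. appell a n (snd p)) N (fst p))
           \<in> o[F](\<lambda>p. 1 / fst p ^ (N + 1))"
proof -
  define r where "r k p = 1 / (fst p + snd p) ^ (k + 1)
      - neg_binomial_psum k (N - k) (snd p / fst p) / fst p ^ (k + 1)" for k and p :: "real \<times> real"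
  have "(\<lambda>x :: real. 1 / x ^ (N + 2)) \<in> o[at_top](\<lambda>x. 1 / x ^ (N + 1))"
    by real_asymp
  then have small: "(\<lambda>p. 1 / fst p ^ (N + 2)) \<in> o[F](\<lambda>p. 1 / fst p ^ (N + 1))"
    unfolding F_def by (rule landau_o.small.compose[OF _ filterlim_fst])
  have "r k \<in> O[F](\<lambda>p. 1 / fst p ^ (N + 2))" if "k \<le> N" for k
    using inverse_power_shift_expansion[OF assms(1), of k "N - k"] that
    unfolding r_def F_def by simp
  then have "r k \<in> o[F](\<lambda>p. 1 / fst p ^ (N + 1))" if "k \<le> N" for k
    using that small by (blast intro: landau_o.big_small_trans)
  then have "(\<lambda>p. \<Sum>k\<le>N. (-1) ^ k * a k * r k p) \<in> o[F](\<lambda>p. 1 / fst p ^ (N + 1))"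
    by (intro big_sum_in_smallo) simp
  moreover have "\<forall>\<^sub>F p in F. (\<Sum>k\<le>N. (-1) ^ k * a k * r k p) =
      alt_psum a N (fst p + snd p) - alt_psum (\<lambda>n. appell a n (snd p)) N (fst p)"
    using eventually_prod_bounded_large[of 1 T] unfolding F_def
  proof eventually_elim
    case (elim p)
    then have "fst p \<noteq> 0" by auto
    then show ?case
      unfolding alt_psum_appell[OF \<open>fst p \<noteq> 0\<close>] alt_psum_def[of a]
      by (simp add: r_def sum_subtractf right_diff_distrib)
  qed
  ultimately show ?thesis
    by (simp add: landau_o.small.in_cong)
qed

text \<open>For \<open>x \<ge> 2 * T\<close> one has \<open>x + t \<ge> x / 2\<close>, whence the
  constant \<open>2 ^ n\<close>. This converts error terms in \<open>x + t\<close> into error terms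
  in \<open>x\<close>.\<close>

lemma inverse_power_shift_bigo:
  fixes T :: real
  assumes "T > 0"
  shows "(\<lambda>p. 1 / (fst p + snd p) ^ n)
           \<in> O[at_top \<times>\<^sub>F principal {t. \<bar>t\<bar> \<le> T}](\<lambda>p. 1 / fst p ^ n)"
proof (rule bigoI[where c = "2 ^ n"])
  show "\<forall>\<^sub>F p in at_top \<times>\<^sub>F principal {t. \<bar>t\<bar> \<le> T}.
      norm (1 / (fst p + snd p) ^ n) \<le> 2 ^ n * norm (1 / fst p ^ n)"
    using eventually_prod_bounded_large[of "2 * T" T]
  proof eventually_elim
    case (elim p)
    with assms have "0 < fst p / 2" "fst p / 2 \<le> fst p + snd p" by auto
    then have "1 / (fst p + snd p) ^ n \<le> 1 / (fst p / 2) ^ n"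
      by (intro divide_left_mono power_mono mult_pos_pos zero_less_power) auto
    also have "\<dots> = 2 ^ n * (1 / fst p ^ n)"
      by (simp add: power_divide)
    finally show ?case
      using \<open>0 < fst p / 2\<close> \<open>fst p / 2 \<le> fst p + snd p\<close> by simp
  qed
qed

text \<open>The error splits into the error of the expansion of \<open>f\<close> at
  \<open>x + t\<close> and the difference between the shifted partial sum of \<open>a\<close> and
  the Appell partial sum at \<open>x\<close>; each is small along the product filter.\<close>

lemma has_alt_expansion_shift_uniform:
  assumes "has_alt_expansion f a" "T > 0"
  shows "uniform_smallo {t. \<bar>t\<bar> \<le> T}
    (\<lambda>x t. f (x + t) - alt_psum (\<lambda>n. appell a n t) N x) (\<lambda>x. 1 / x ^ (N + 1))"
proof -
  let ?F = "at_top \<times>\<^sub>F principal {t. \<bar>t\<bar> \<le> T}"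
  have "(\<lambda>x. f x - alt_psum a N x) \<in> o[at_top](\<lambda>x. 1 / x ^ (N + 1))"
    using assms(1) by (simp add: has_alt_expansion_def)
  then have "(\<lambda>p. f (fst p + snd p) - alt_psum a N (fst p + snd p))
      \<in> o[?F](\<lambda>p. 1 / (fst p + snd p) ^ (N + 1))"
    by (rule landau_o.small.compose[OF _ filterlim_add_prod_bounded])
  then have "(\<lambda>p. f (fst p + snd p) - alt_psum a N (fst p + snd p))
      \<in> o[?F](\<lambda>p. 1 / fst p ^ (N + 1))"
    using inverse_power_shift_bigo[OF assms(2)] by (rule landau_o.small_big_trans)
  from sum_in_smallo(1)[OF this alt_psum_shift[OF assms(2), of a N]] show ?thesis
    by (simp add: uniform_smallo_iff_smallo_prod)
qed

theorem corollary2p2: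
  fixes a :: "nat \<Rightarrow> real" and f :: "real \<Rightarrow> real"
  assumes "a 0 \<noteq> 0"
    and "has_alt_expansion f a"
  shows "(\<forall>K N. compact K \<longrightarrow>
            uniform_smallo K (\<lambda>x t. f (x + t) - alt_psum (\<lambda>n. appell a n t) N x)
              (\<lambda>x. 1 / x ^ (N + 1))) \<and>
         (\<forall>T>0. \<forall>N.
            uniform_smallo {t. \<bar>t\<bar> \<le> T} (\<lambda>x t. f (x + t) - alt_psum (\<lambda>n. appell a n t) N x)
              (\<lambda>x. 1 / x ^ (N + 1))) \<and>
         (\<forall>T>0. \<forall>\<tau> :: real \<Rightarrow> real. (\<forall>x>0. \<bar>\<tau> x\<bar> \<le> T) \<longrightarrow>
            (\<forall>N. (\<lambda>x. f (x + \<tau> x) - alt_psum (\<lambda>n. appell a n (\<tau> x)) N x)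
                   \<in> o[at_top](\<lambda>x. 1 / x ^ (N + 1))))"
proof (intro conjI allI impI)
  fix K :: "real set" and N
  assume "compact K"
  then have "bounded K"
    by (rule compact_imp_bounded)
  then obtain T where "T > 0" "K \<subseteq> {t. \<bar>t\<bar> \<le> T}"
    unfolding bounded_pos by auto
  then show "uniform_smallo K (\<lambda>x t. f (x + t) - alt_psum (\<lambda>n. appell a n t) N x)
      (\<lambda>x. 1 / x ^ (N + 1))"
    using has_alt_expansion_shift_uniform[OF assms(2)] uniform_smallo_subset by blast
next
  fix T :: real and N
  assume "T > 0"
  then show "uniform_smallo {t. \<bar>t\<bar> \<le> T}
      (\<lambda>x t. f (x + t) - alt_psum (\<lambda>n. appell a n t) N x) (\<lambda>x. 1 / x ^ (N + 1))"
    by (rule has_alt_expansion_shift_uniform[OF assms(2)])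
next
  fix T :: real and \<tau> :: "real \<Rightarrow> real" and N
  assume "T > 0" and \<tau>: "\<forall>x>0. \<bar>\<tau> x\<bar> \<le> T"
  have "\<forall>\<^sub>F x in at_top. \<tau> x \<in> {t. \<bar>t\<bar> \<le> T}"
    using eventually_gt_at_top[of 0] by eventually_elim (use \<tau> in auto)
  with has_alt_expansion_shift_uniform[OF assms(2) \<open>T > 0\<close>]
  show "(\<lambda>x. f (x + \<tau> x) - alt_psum (\<lambda>n. appell a n (\<tau> x)) N x)
      \<in> o[at_top](\<lambda>x. 1 / x ^ (N + 1))"
    by (rule uniform_smallo_imp_smallo_family)
qed

end
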